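(* Let $X$ be a finite nonempty set and let $\mathcal F\subseteq 2^{X}$ be a family of subsets of $X$ with $|\mathcal F|>2^{|X|-1}$. Then there is a subfamily $\mathcal G\subseteq\mathcal F$ with $|\mathcal G|\le\lceil\log_2|X|\rceil+1$ that separates $X$.
   Context: A subset $F\subseteq X$ separates two elements $x,y\in X$ if it contains exactly one of them. A family $\mathcal G$ of subsets of $X$ separates $X$ if every pair of distinct elements of $X$ is separated by at least one member of $\mathcal G$. *)

theory Defs
  imports Complex_Main
begin

definition separates :: "'a set \<Rightarrow> 'a \<Rightarrow> 'a \<Rightarrow> bool" where
  "separates F x y \<longleftrightarrow> (x \<in> F \<and> y \<notin> F) \<or> (x \<notin> F \<and> y \<in> F)"

definition separating_family :: "'a set set \<Rightarrow> 'a set \<Rightarrow> bool" where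
  "separating_family G X \<longleftrightarrow> (\<forall>x\<in>X. \<forall>y\<in>X. x \<noteq> y \<longrightarrow> (\<exists>F\<in>G. separates F x y))"

end

theory Submission
  imports Defs
begin

text \<open>
  The induction halves \<open>X\<close> and strengthens the claim: every two points are to be separated by some
  chosen set and left unseparated by another one. Match a half \<open>S\<close> of \<open>X\<close> injectively into the rest
  \<open>R\<close>. A set \<open>A\<close> is determined by its trace \<open>A \<inter> R\<close> and its type, the set of those \<open>s \<in> S\<close> that \<open>A\<close>
  separates from their partners. Since \<open>\<F>\<close> contains more than half of all sets, there is a
  type \<open>T\<close> such that more than half of all traces come from members of type \<open>T\<close> and some member \<open>D\<close>
  has the complementary type \<open>S - T\<close>. Induction on \<open>R\<close> handles points in different pairs, and adding \<open>D\<close>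
  handles partners.
\<close>

definition strongly_separating_family :: "'a set set \<Rightarrow> 'a set \<Rightarrow> bool" where
  "strongly_separating_family G X \<longleftrightarrow>
     (\<forall>x\<in>X. \<forall>y\<in>X. x \<noteq> y \<longrightarrow> (\<exists>A\<in>G. separates A x y) \<and> (\<exists>A\<in>G. \<not> separates A x y))"

lemma strongly_separating_family_imp_separating:
  "strongly_separating_family G X \<Longrightarrow> separating_family G X"
  unfolding strongly_separating_family_def separating_family_def by blast

definition split_pairs :: "('a \<Rightarrow> 'a) \<Rightarrow> 'a set \<Rightarrow> 'a set \<Rightarrow> 'a set" where
  "split_pairs p S A = {s \<in> S. (s \<in> A) \<noteq> (p s \<in> A)}"

lemma split_pairs_subset: "split_pairs p S A \<subseteq> S"
  by (auto simp: split_pairs_def)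

text \<open>The inequality is exclusive or: \<open>s\<close> in \<open>S\<close> copies its partner,
  flipped exactly when \<open>s\<close> lies in the type. Points of \<open>R\<close> are never
  flipped, as the type lies in \<open>S\<close>.\<close>

lemma mem_iff_split_pairs:
  assumes "p ` S \<subseteq> R" "x \<in> R \<union> S" "R \<inter> S = {}"
  shows "x \<in> A \<longleftrightarrow> ((if x \<in> S then p x else x) \<in> A \<inter> R) \<noteq> (x \<in> split_pairs p S A)"
  using assms by (auto simp: split_pairs_def)

lemma inj_on_trace:
  assumes "p ` S \<subseteq> R" "R \<inter> S = {}"
  shows "inj_on (\<lambda>A. A \<inter> R) {A. A \<subseteq> R \<union> S \<and> split_pairs p S A = T}"
proof (rule inj_onI)
  fix A B
  assume A: "A \<in> {A. A \<subseteq> R \<union> S \<and> split_pairs p S A = T}"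
    and B: "B \<in> {A. A \<subseteq> R \<union> S \<and> split_pairs p S A = T}" and eq: "A \<inter> R = B \<inter> R"
  have "x \<in> A \<longleftrightarrow> x \<in> B" if "x \<in> R \<union> S" for x
    using mem_iff_split_pairs[OF assms(1) that assms(2), of A]
      mem_iff_split_pairs[OF assms(1) that assms(2), of B] A B eq by simp
  then show "A = B" using A B by blast
qed

text \<open>All of \<open>G\<close> has the same type, so replacing \<open>x\<close>,
  \<open>y\<close> by representatives in \<open>R\<close> either keeps or reverses separation for
  every member of \<open>G\<close> at once. Having both a separating and a non-separating set
  survives reversal; this is why the strong notion is the one to induct on.\<close>

lemma strongly_separating_family_extend:
  assumes p: "p ` S \<subseteq> R" "inj_on p S" "R \<inter> S = {}"
    and G: "strongly_separating_family ((\<lambda>A. A \<inter> R) ` G) R"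
    and types: "\<And>A. A \<in> G \<Longrightarrow> split_pairs p S A = T" "split_pairs p S D = S - T"
    and ne: "G \<noteq> {}"
  shows "strongly_separating_family (insert D G) (R \<union> S)"
  unfolding strongly_separating_family_def
proof (intro ballI impI)
  fix x y assume xy: "x \<in> R \<union> S" "y \<in> R \<union> S" "x \<noteq> y"
  define r where "r = (\<lambda>x. if x \<in> S then p x else x)"
  have r: "r x \<in> R" "r y \<in> R" using xy p by (auto simp: r_def)
  have mem: "z \<in> A \<longleftrightarrow> (r z \<in> A \<inter> R) \<noteq> (z \<in> T)" if "A \<in> G" "z \<in> R \<union> S" for A z
    using mem_iff_split_pairs[OF p(1) that(2) p(3), of A] types(1)[OF that(1)] by (simp add: r_def)
  show "(\<exists>A\<in>insert D G. separates A x y) \<and> (\<exists>A\<in>insert D G. \<not> separates A x y)"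
  proof (cases "r x = r y")
    case False
    then obtain A B where AB: "A \<in> G" "separates (A \<inter> R) (r x) (r y)"
      "B \<in> G" "\<not> separates (B \<inter> R) (r x) (r y)"
      using G r unfolding strongly_separating_family_def by blast
    have flip: "separates C x y \<longleftrightarrow> (separates (C \<inter> R) (r x) (r y) \<longleftrightarrow> (x \<in> T \<longleftrightarrow> y \<in> T))"
      if "C \<in> G" for C
      unfolding separates_def using mem[OF that xy(1)] mem[OF that xy(2)] by blast
    show ?thesis
      using flip[OF AB(1)] flip[OF AB(3)] AB by blast
  next
    case True
    \<comment> \<open>Distinct points with one representative are partners: \<open>p\<close> is
      injective on \<open>S\<close>, so they cannot both lie in \<open>S\<close>.\<close>
    obtain s where s: "s \<in> S" and cases: "x = s \<and> y = p s \<or> y = s \<and> x = p s"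
      using True xy p unfolding r_def by (auto split: if_splits dest: inj_onD)
    have sep: "separates C x y \<longleftrightarrow> s \<in> split_pairs p S C" for C
      using cases s by (auto simp: separates_def split_pairs_def)
    \<comment> \<open>Since \<open>s\<close> lies in exactly one of \<open>T\<close> and
      \<open>S - T\<close>, one of \<open>A\<close> and \<open>D\<close> separates the partners and
      the other does not.\<close>
    obtain A where "A \<in> G" using ne by blast
    then show ?thesis using sep[of A] sep[of D] types s by blast
  qed
qed

text \<open>Averaging over the 2^|S| types: each set is counted twice when a type is paired with its
  complement, so some complementary pair of classes has total size above 2^|R|.\<close>

lemma exists_popular_type:
  fixes \<F> :: "'a set set"
  assumes fin: "finite R" "finite S" and p: "p ` S \<subseteq> R" "R \<inter> S = {}" and ne: "R \<noteq> {}"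
    and \<F>: "\<F> \<subseteq> Pow (R \<union> S)" "card \<F> > 2 ^ (card (R \<union> S) - 1)"
  obtains T D where "T \<subseteq> S" "D \<in> \<F>" "split_pairs p S D = S - T"
    "card {A \<in> \<F>. split_pairs p S A = T} > 2 ^ (card R - 1)"
proof -
  define \<T> where "\<T> T = {A \<in> \<F>. split_pairs p S A = T}" for T
  have finF: "finite \<F>" using \<F>(1) fin by (meson finite_Pow_iff finite_UnI finite_subset)
  \<comment> \<open>For empty \<open>Y\<close> truncated subtraction would make this false; hence
    the care that \<open>R\<close> is nonempty.\<close>
  have pow: "(2::nat) * 2 ^ (card Y - 1) = 2 ^ card Y" if "finite Y" "Y \<noteq> {}" for Y :: "'a set"
    using that by (simp add: card_gt_0_iff flip: power_Suc)
  have le: "card (\<T> T) \<le> 2 ^ card R" for T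
  proof -
    have "inj_on (\<lambda>A. A \<inter> R) (\<T> T)"
      by (rule inj_on_subset[OF inj_on_trace[OF p, of T]]) (use \<F>(1) in \<open>auto simp: \<T>_def\<close>)
    then have "card (\<T> T) \<le> card (Pow R)"
      by (rule card_inj_on_le) (use fin in auto)
    then show ?thesis using fin by (simp add: card_Pow)
  qed
  have total: "(\<Sum>T\<in>Pow S. card (\<T> T)) = card \<F>"
  proof -
    have "\<F> = (\<Union>T\<in>Pow S. \<T> T)" using split_pairs_subset[of p S] by (auto simp: \<T>_def)
    moreover have "card (\<Union>T\<in>Pow S. \<T> T) = (\<Sum>T\<in>Pow S. card (\<T> T))"
      by (rule card_UN_disjoint) (use fin finF in \<open>auto simp: \<T>_def\<close>)
    ultimately show ?thesis by simp
  qed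
  have "(\<Sum>T\<in>Pow S. card (\<T> (S - T))) = (\<Sum>T\<in>Pow S. card (\<T> T))"
    by (rule sum.reindex_bij_witness[where i = "\<lambda>T. S - T" and j = "\<lambda>T. S - T"]) auto
  then have sum2: "(\<Sum>T\<in>Pow S. card (\<T> T) + card (\<T> (S - T))) = 2 * card \<F>"
    using total by (simp add: sum.distrib)
  have "\<exists>T\<in>Pow S. card (\<T> T) + card (\<T> (S - T)) > 2 ^ card R"
  proof (rule ccontr)
    assume "\<not> ?thesis"
    then have "(\<Sum>T\<in>Pow S. card (\<T> T) + card (\<T> (S - T))) \<le> (\<Sum>T\<in>Pow S. 2 ^ card R)"
      by (intro sum_mono) (simp add: not_less)
    also have "\<dots> = 2 ^ card (R \<union> S)"
      using fin p by (simp add: card_Pow card_Un_disjoint power_add)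
    finally have "2 * card \<F> \<le> 2 ^ card (R \<union> S)" unfolding sum2 .
    then show False using \<F>(2) pow[of "R \<union> S"] fin ne by auto
  qed
  then obtain T where T: "T \<subseteq> S" "card (\<T> T) + card (\<T> (S - T)) > 2 ^ card R" by blast
  \<comment> \<open>The larger class of the pair exceeds half of 2^|R|. By \<open>le\<close> it
    cannot account for the whole total, so the other class is nonempty.\<close>
  have "\<exists>T\<subseteq>S. card (\<T> T) > 2 ^ (card R - 1) \<and> card (\<T> (S - T)) > 0"
  proof (cases "card (\<T> T) > 2 ^ (card R - 1)")
    case True
    then show ?thesis using T le[of T] by (intro exI[of _ T]) auto
  next
    case False
    then have "card (\<T> (S - T)) > 2 ^ (card R - 1)"
      using T(2) pow[of R] fin ne by linarith
    moreover have "S - (S - T) = T" using T(1) by blast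
    ultimately show ?thesis using T le[of "S - T"] by (intro exI[of _ "S - T"]) auto
  qed
  then obtain U where U: "U \<subseteq> S" "card (\<T> U) > 2 ^ (card R - 1)" "card (\<T> (S - U)) > 0" by blast
  then obtain D where "D \<in> \<T> (S - U)" by (metis card_gt_0_iff ex_in_conv)
  then show thesis using that U by (auto simp: \<T>_def)
qed

lemma exists_strongly_separating_subfamily:
  assumes "finite X" "X \<noteq> {}" "\<F> \<subseteq> Pow X" "card \<F> > 2 ^ (card X - 1)" "card X \<le> 2 ^ k"
  \<comment> \<open>Nonemptiness matters when \<open>R\<close> is a singleton: strong separation is
    then vacuous, yet partners need a set besides \<open>D\<close>.\<close>
  shows "\<exists>\<G>\<subseteq>\<F>. \<G> \<noteq> {} \<and> card \<G> \<le> k + 1 \<and> strongly_separating_family \<G> X"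
  using assms
proof (induction k arbitrary: X \<F>)
  case 0
  obtain A where A: "A \<in> \<F>" using 0 by fastforce
  have "card X = Suc 0" using 0 by (simp add: Suc_leI card_gt_0_iff le_antisym)
  then have "strongly_separating_family {A} X"
    by (auto simp: strongly_separating_family_def card_Suc_eq)
  then show ?case using A by (intro exI[of _ "{A}"]) auto
next
  case (Suc k)
  \<comment> \<open>\<open>S\<close> is the smaller half: it then embeds in \<open>R\<close>, and
    |R|, which is |X|/2 rounded up, is still at most 2^k.\<close>
  obtain S where S: "S \<subseteq> X" "card S = card X div 2"
    using obtain_subset_with_card_n[of "card X div 2" X] by (metis div_le_dividend)
  define R where "R = X - S"
  have X: "X = R \<union> S" and disj: "R \<inter> S = {}" using S by (auto simp: R_def)
  have fin: "finite R" "finite S" using Suc.prems(1) X by auto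
  have cR: "card R = card X - card X div 2"
    using S Suc.prems(1) fin by (simp add: R_def card_Diff_subset)
  have "card X > 0" using Suc.prems by (simp add: card_gt_0_iff)
  then have ne: "R \<noteq> {}" using cR by (intro notI) simp
  have Rk: "card R \<le> 2 ^ k" using cR Suc.prems(5) by simp
  have cS: "card S \<le> card R" using cR S(2) by linarith
  obtain p where p: "p ` S \<subseteq> R" "inj_on p S"
    using card_le_inj[OF fin(2) fin(1)] cS by blast
  obtain T D where TD: "T \<subseteq> S" "D \<in> \<F>" "split_pairs p S D = S - T"
    and big: "card {A \<in> \<F>. split_pairs p S A = T} > 2 ^ (card R - 1)"
    using exists_popular_type[OF fin p(1) disj ne Suc.prems(3,4)[unfolded X]] .
  let ?\<A> = "{A \<in> \<F>. split_pairs p S A = T}"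
  let ?tr = "\<lambda>A. A \<inter> R"
  have inj: "inj_on ?tr ?\<A>"
    by (rule inj_on_subset[OF inj_on_trace[OF p(1) disj, of T]]) (use Suc.prems(3) X in auto)
  have "?tr ` ?\<A> \<subseteq> Pow R" "card (?tr ` ?\<A>) > 2 ^ (card R - 1)"
    using big card_image[OF inj] by auto
  from Suc.IH[OF fin(1) ne this Rk] obtain \<H> where \<H>: "\<H> \<subseteq> ?tr ` ?\<A>" "\<H> \<noteq> {}" "card \<H> \<le> k + 1"
    "strongly_separating_family \<H> R" by blast
  \<comment> \<open>One preimage per trace suffices, so lifting to \<open>\<F>\<close> costs no
    extra sets.\<close>
  then obtain \<G> where \<G>: "\<G> \<subseteq> ?\<A>" "\<H> = ?tr ` \<G>" by (auto simp: subset_image_iff)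
  have "card \<G> = card \<H>" using card_image[OF inj_on_subset[OF inj \<G>(1)]] \<G>(2) by simp
  then have "card (insert D \<G>) \<le> Suc k + 1" using \<H>(3) 
    by (simp add: card_insert_le_m1)
  moreover have "strongly_separating_family (insert D \<G>) X"
    unfolding X by (rule strongly_separating_family_extend[where T = T and p = p])
      (use p disj \<H> \<G> TD in auto)
  ultimately show ?case using \<G>(1) TD(2) by (intro exI[of _ "insert D \<G>"]) auto
qed

theorem theorem1:
  fixes X :: "'a set" and \<F> :: "'a set set"
  assumes "finite X" and "X \<noteq> {}"
    and "\<F> \<subseteq> Pow X"
    and "card \<F> > 2 ^ (card X - 1)"
  shows "\<exists>\<G>. \<G> \<subseteq> \<F> \<and> int (card \<G>) \<le> \<lceil>log 2 (real (card X))\<rceil> + 1 \<and> separating_family \<G> X"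
proof -
  define k where "k = nat \<lceil>log 2 (real (card X))\<rceil>"
  \<comment> \<open>|X| is at least 1, so the logarithm is nonnegative and \<open>nat\<close> loses
    nothing.\<close>
  have pos: "card X \<ge> 1" using assms by (simp add: Suc_leI card_gt_0_iff)
  then have "log 2 (real (card X)) \<ge> 0" by simp
  then have k: "int k = \<lceil>log 2 (real (card X))\<rceil>" unfolding k_def by simp
  then have "log 2 (real (card X)) \<le> real k" by linarith
  then have "real (card X) \<le> 2 powr real k" using pos by (simp add: log_le_iff)
  then have "real (card X) \<le> real (2 ^ k)" by (simp add: powr_realpow)
  then have "card X \<le> 2 ^ k" by (simp only: of_nat_le_iff)
  from exists_strongly_separating_subfamily[OF assms this] obtain \<G> where
    "\<G> \<subseteq> \<F>" "card \<G> \<le> k + 1" "strongly_separating_family \<G> X" by blast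
  then show ?thesis
    using k strongly_separating_family_imp_separating by (intro exI[of _ \<G>]) auto
qed

end
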